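(* Let $C,D\subseteq\mathbb{R}^n$ be nonempty, closed and convex sets with $C$ affine and $C\cap D\neq\emptyset$, and let $S=P_D^{\alpha_2}P_C^{\alpha_1}$. Suppose that the parameters satisfy at least one of the following: A1. $\alpha_1,\alpha_2\in(0,2)$ and $\alpha\in(0,\tfrac1\beta)$, where $$\beta=\frac{\frac{\alpha_1}{2-\alpha_1}+\frac{\alpha_2}{2-\alpha_2}}{1+\frac{\alpha_1}{2-\alpha_1}+\frac{\alpha_2}{2-\alpha_2}};$$ A2. $\alpha\in(0,1)$ and $\alpha_1,\alpha_2\in(0,2]$ with at most one $\alpha_i$ equal to $2$; A3. $\alpha\in(0,1)$ and $\alpha_1=\alpha_2=2$. Let $\epsilon\in(0,1)$ and $\alpha^{\max}\ge\alpha$ be fixed, and let $(x^k)_{k\ge 0}$ be any sequence in $\mathbb{R}^n$ generated by the projected line search algorithm with these parameters (described in the context). Then the fixed-point residual $r(x^k)=Sx^k-x^k$ converges to $0$ as $k\to\infty$.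
   Context: For a nonempty closed convex set $\Omega\subseteq\mathbb{R}^n$, $\Pi_\Omega$ denotes the orthogonal (Euclidean) projection onto $\Omega$, and for $\gamma\in(0,2]$ the relaxed projection is $P_\Omega^{\gamma}=(1-\gamma)\mathrm{Id}+\gamma\,\Pi_\Omega$. For $x\in\mathbb{R}^n$ the residual is $r(x):=Sx-x$. Projected line search algorithm: start from an arbitrary $x^0\in\mathbb{R}^n$. At each iteration $k\ge0$, put $r^k:=r(x^k)=Sx^k-x^k$. Then $x^{k+1}$ is chosen in one of two ways: (i) nominal step: $x^{k+1}:=x^k+\alpha r^k$; (ii) line search step: $x^{k+1}:=\Pi_C(x^k+\alpha_k r^k)$ for some $\alpha_k\in(\alpha,\alpha^{\max}]$. This is allowed only if $$\|r(x^{k+1})\|_2\le(1-\epsilon)\,\|r(x^{i_{\mathrm{LS}}+1})\|_2,$$ where $i_{\mathrm{LS}}<k$ is the index of the most recent earlier iteration at which a line search step (ii) was taken, so that $x^{i_{\mathrm{LS}}+1}$ is the iterate produced by that line search step. If no line search step has been taken before iteration $k$, no acceptance inequality is imposed on the step. At every iteration a nominal step is always permitted; a line search step may be taken at any iteration at which an admissible $\alpha_k$ exists. *)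

theory Defs
  imports "HOL-Analysis.Analysis"
begin

definition relaxed_projection :: "real \<Rightarrow> 'a::euclidean_space set \<Rightarrow> 'a \<Rightarrow> 'a" where
  "relaxed_projection \<gamma> \<Omega> x = (1 - \<gamma>) *\<^sub>R x + \<gamma> *\<^sub>R closest_point \<Omega> x"

definition residual :: "('a::real_vector \<Rightarrow> 'a) \<Rightarrow> 'a \<Rightarrow> 'a" where
  "residual S x = S x - x"

definition beta :: "real \<Rightarrow> real \<Rightarrow> real" where
  "beta \<alpha>1 \<alpha>2 =
     (\<alpha>1 / (2 - \<alpha>1) + \<alpha>2 / (2 - \<alpha>2)) / (1 + \<alpha>1 / (2 - \<alpha>1) + \<alpha>2 / (2 - \<alpha>2))"

definition nominal_step :: "('a::real_vector \<Rightarrow> 'a) \<Rightarrow> real \<Rightarrow> 'a \<Rightarrow> 'a \<Rightarrow> bool" where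
  "nominal_step S \<alpha> y y' \<longleftrightarrow> y' = y + \<alpha> *\<^sub>R residual S y"

definition projected_step ::
    "'a::euclidean_space set \<Rightarrow> ('a \<Rightarrow> 'a) \<Rightarrow> real \<Rightarrow> real \<Rightarrow> 'a \<Rightarrow> 'a \<Rightarrow> bool" where
  "projected_step C S \<alpha> \<alpha>max y y' \<longleftrightarrow>
     (\<exists>a. \<alpha> < a \<and> a \<le> \<alpha>max \<and> y' = closest_point C (y + a *\<^sub>R residual S y))"

(* L is the set of iterations at which a line search step is taken; for an
   iteration k in L with an earlier line search step, Max {i \<in> L. i < k} is
   the most recent one. *)
definition line_search_accepted ::
    "('a::real_normed_vector \<Rightarrow> 'a) \<Rightarrow> real \<Rightarrow> nat set \<Rightarrow> (nat \<Rightarrow> 'a) \<Rightarrow> nat \<Rightarrow> bool" where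
  "line_search_accepted S \<epsilon> L x k \<longleftrightarrow>
     ({i \<in> L. i < k} \<noteq> {} \<longrightarrow>
        norm (residual S (x (Suc k)))
          \<le> (1 - \<epsilon>) * norm (residual S (x (Suc (Max {i \<in> L. i < k})))))"

(* The algorithm is nondeterministic (any admissible step may be taken), so it is
   described by the sequences it can generate. The steps taken are recorded in L,
   since they cannot in general be recovered from x alone. *)
definition projected_line_search ::
    "'a::euclidean_space set \<Rightarrow> ('a \<Rightarrow> 'a) \<Rightarrow> real \<Rightarrow> real \<Rightarrow> real \<Rightarrow> (nat \<Rightarrow> 'a) \<Rightarrow> bool" where
  "projected_line_search C S \<alpha> \<alpha>max \<epsilon> x \<longleftrightarrow>
     (\<exists>L. \<forall>k.
        (k \<notin> L \<longrightarrow> nominal_step S \<alpha> (x k) (x (Suc k))) \<and>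
        (k \<in> L \<longrightarrow> projected_step C S \<alpha> \<alpha>max (x k) (x (Suc k)) \<and>
                  line_search_accepted S \<epsilon> L x k))"

end

theory Submission
  imports Defs
begin

text \<open>The residual of an averaged map does not increase along a nominal step, so at a late
  iterate it is at most the residual right after the latest line search step. If there are
  infinitely many line search steps, these residuals decay geometrically by the acceptance test.
  Otherwise the iteration is eventually the Krasnosel'skii--Mann iteration, which is Fejer monotone
  with respect to the points of \<open>C \<inter> D\<close>.\<close>

section \<open>Averaged maps and relaxed projections\<close>

text \<open>For \<open>c \<ge> 0\<close>, this says that \<open>T\<close> is \<open>1 / (1 + c)\<close>-averaged.\<close>

definition averaged_map :: "real \<Rightarrow> ('a::real_inner \<Rightarrow> 'a) \<Rightarrow> bool" where
  "averaged_map c T \<longleftrightarrow>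
     (\<forall>x y. (norm (T x - T y))\<^sup>2 + c * (norm (residual T x - residual T y))\<^sup>2 \<le> (norm (x - y))\<^sup>2)"

text \<open>Expanding the square of \<open>(x - y) + q\<close>, with \<open>q\<close> the difference
  of the residuals, turns averagedness into a bound on the cross term that a step along the residual
  produces.\<close>

lemma averaged_map_cocoercive:
  assumes "averaged_map c T"
  shows "2 * ((x - y) \<bullet> (residual T x - residual T y))
           \<le> - (1 + c) * (norm (residual T x - residual T y))\<^sup>2"
proof -
  define d q where "d = x - y" and "q = residual T x - residual T y"
  have "T x - T y = d + q"
    by (simp add: d_def q_def residual_def)
  then have "(norm (d + q))\<^sup>2 + c * (norm q)\<^sup>2 \<le> (norm d)\<^sup>2"
    using assms unfolding averaged_map_def d_def q_def by metis
  moreover have "(norm (d + q))\<^sup>2 = (norm d)\<^sup>2 + 2 * (d \<bullet> q) + (norm q)\<^sup>2"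
    unfolding power2_norm_eq_inner
    by (simp add: inner_add_left inner_add_right inner_commute)
  ultimately show ?thesis
    unfolding d_def[symmetric] q_def[symmetric] by (simp add: algebra_simps)
qed

text \<open>Sum of the two obtuse-angle inequalities, each projection tested against the other
  projected point.\<close>

lemma closest_point_firmly_nonexpansive:
  fixes \<Omega> :: "'a::euclidean_space set"
  assumes "convex \<Omega>" "closed \<Omega>" "\<Omega> \<noteq> {}"
  shows "(norm (closest_point \<Omega> x - closest_point \<Omega> y))\<^sup>2
           \<le> (x - y) \<bullet> (closest_point \<Omega> x - closest_point \<Omega> y)"
proof -
  let ?p = "closest_point \<Omega>"
  have "(x - ?p x) \<bullet> (?p y - ?p x) \<le> 0" "(y - ?p y) \<bullet> (?p x - ?p y) \<le> 0"
    using assms by (auto intro!: closest_point_dot closest_point_in_set)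
  then show ?thesis
    by (simp add: power2_norm_eq_inner inner_diff_left inner_diff_right inner_commute)
qed

lemma averaged_map_relaxed_projection:
  fixes \<Omega> :: "'a::euclidean_space set"
  assumes "convex \<Omega>" "closed \<Omega>" "\<Omega> \<noteq> {}" "\<gamma> > 0"
  shows "averaged_map ((2 - \<gamma>) / \<gamma>) (relaxed_projection \<gamma> \<Omega>)"
  unfolding averaged_map_def
proof (intro allI)
  fix x y :: 'a
  define d where "d = x - y"
  define p where "p = closest_point \<Omega> x - closest_point \<Omega> y"
  have T: "relaxed_projection \<gamma> \<Omega> x - relaxed_projection \<gamma> \<Omega> y = d + \<gamma> *\<^sub>R (p - d)"
    by (simp add: relaxed_projection_def d_def p_def algebra_simps)
  have R: "residual (relaxed_projection \<gamma> \<Omega>) x - residual (relaxed_projection \<gamma> \<Omega>) y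
      = \<gamma> *\<^sub>R (p - d)"
    by (simp add: relaxed_projection_def residual_def d_def p_def algebra_simps)
  have firm: "p \<bullet> p \<le> d \<bullet> p"
    using closest_point_firmly_nonexpansive[OF assms(1-3), of x y]
    by (simp add: d_def p_def power2_norm_eq_inner)
  \<comment> \<open>The coefficient makes the multiples of the squared norm of \<open>p - d\<close>
    add up to \<open>2 * \<gamma>\<close>, so the excess over \<open>d\<close> collapses to
    \<open>2 * \<gamma>\<close> times \<open>(p - d) \<bullet> p\<close>.\<close>
  have "(norm (d + \<gamma> *\<^sub>R (p - d)))\<^sup>2 + (2 - \<gamma>) / \<gamma> * (norm (\<gamma> *\<^sub>R (p - d)))\<^sup>2
      = (norm d)\<^sup>2 + 2 * \<gamma> * (p \<bullet> p - d \<bullet> p)"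
    using \<open>\<gamma> > 0\<close> unfolding power2_norm_eq_inner
    by (simp add: inner_add_left inner_add_right inner_diff_left inner_diff_right
        inner_commute field_simps)
  also have "\<dots> \<le> (norm d)\<^sup>2"
    using firm \<open>\<gamma> > 0\<close> by (simp add: mult_nonneg_nonpos)
  finally show "(norm (relaxed_projection \<gamma> \<Omega> x - relaxed_projection \<gamma> \<Omega> y))\<^sup>2
      + (2 - \<gamma>) / \<gamma> * (norm (residual (relaxed_projection \<gamma> \<Omega>) x
          - residual (relaxed_projection \<gamma> \<Omega>) y))\<^sup>2 \<le> (norm (x - y))\<^sup>2"
    unfolding T R d_def[symmetric] .
qed

text \<open>For \<open>c1 = c2 = 0\<close> the constant is \<open>0 / 0 = 0\<close>, as needed for two reflections.\<close>

lemma averaged_map_comp: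
  assumes "averaged_map c1 T1" "averaged_map c2 T2" "c1 \<ge> 0" "c2 \<ge> 0"
  shows "averaged_map (c1 * c2 / (c1 + c2)) (T2 \<circ> T1)"
  unfolding averaged_map_def
proof (intro allI)
  fix x y
  define u where "u = residual T1 x - residual T1 y"
  define v where "v = residual T2 (T1 x) - residual T2 (T1 y)"
  have R: "residual (T2 \<circ> T1) x - residual (T2 \<circ> T1) y = u + v"
    by (simp add: u_def v_def residual_def)
  \<comment> \<open>When \<open>c1 + c2 > 0\<close> and \<open>u + v\<close> is fixed, the right
    side is least at \<open>c1 *\<^sub>R u = c2 *\<^sub>R v\<close>, with the left side as its
    value. Hence the square used in the second case.\<close>
  have "c1 * c2 / (c1 + c2) * (norm (u + v))\<^sup>2 \<le> c1 * (norm u)\<^sup>2 + c2 * (norm v)\<^sup>2"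
  proof (cases "c1 + c2 = 0")
    case True
    then show ?thesis using assms(3,4) by simp
  next
    case False
    have "0 \<le> (norm (c1 *\<^sub>R u - c2 *\<^sub>R v))\<^sup>2" by simp
    also have "\<dots> = (c1 + c2) * (c1 * (norm u)\<^sup>2 + c2 * (norm v)\<^sup>2)
        - c1 * c2 * (norm (u + v))\<^sup>2"
      unfolding power2_norm_eq_inner
      by (simp add: inner_add_left inner_add_right inner_diff_left inner_diff_right
          inner_commute algebra_simps)
    finally show ?thesis
      using False assms(3,4) by (simp add: pos_divide_le_eq mult.commute)
  qed
  moreover have "(norm (T1 x - T1 y))\<^sup>2 + c1 * (norm u)\<^sup>2 \<le> (norm (x - y))\<^sup>2"
    using assms(1) by (simp add: averaged_map_def u_def)
  moreover have "(norm (T2 (T1 x) - T2 (T1 y)))\<^sup>2 + c2 * (norm v)\<^sup>2 \<le> (norm (T1 x - T1 y))\<^sup>2"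
    using assms(2) by (simp add: averaged_map_def v_def)
  ultimately show "(norm ((T2 \<circ> T1) x - (T2 \<circ> T1) y))\<^sup>2
      + c1 * c2 / (c1 + c2) * (norm (residual (T2 \<circ> T1) x - residual (T2 \<circ> T1) y))\<^sup>2
      \<le> (norm (x - y))\<^sup>2"
    unfolding R by simp
qed

section \<open>Nominal steps\<close>

text \<open>Since \<open>y' - y\<close> is \<open>\<alpha>\<close> times the old residual,
  cocoercivity bounds the cross term in the expanded square of the new residual, and \<alpha> < 1 +
  c lets it absorb the square of the change.\<close>

lemma nominal_step_residual_le:
  assumes "averaged_map c S" "0 < \<alpha>" "\<alpha> < 1 + c" "nominal_step S \<alpha> y y'"
  shows "norm (residual S y') \<le> norm (residual S y)"
proof -
  define r where "r = residual S y"
  define q where "q = residual S y' - r"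
  have "\<alpha> * (2 * (r \<bullet> q)) \<le> - (1 + c) * (norm q)\<^sup>2"
    using averaged_map_cocoercive[OF assms(1), of y' y] assms(4)
    by (simp add: nominal_step_def r_def q_def mult.left_commute)
  also have "\<dots> \<le> - \<alpha> * (norm q)\<^sup>2"
    using assms(3) by (intro mult_right_mono) auto
  finally have "\<alpha> * (2 * (r \<bullet> q) + (norm q)\<^sup>2) \<le> 0"
    by (simp add: algebra_simps)
  then have "2 * (r \<bullet> q) + (norm q)\<^sup>2 \<le> 0"
    using assms(2) by (simp add: mult_le_0_iff)
  moreover have "(norm (residual S y'))\<^sup>2 = (norm r)\<^sup>2 + 2 * (r \<bullet> q) + (norm q)\<^sup>2"
    unfolding power2_norm_eq_inner
    by (simp add: q_def inner_diff_left inner_diff_right inner_commute)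
  ultimately have "(norm (residual S y'))\<^sup>2 \<le> (norm (residual S y))\<^sup>2"
    unfolding r_def by linarith
  then show ?thesis by (rule power2_le_imp_le) simp
qed

text \<open>Cocoercivity between \<open>y\<close> and the fixed point \<open>z\<close>, whose
  residual vanishes, bounds the cross term in the expanded squared distance after the step.\<close>

lemma nominal_step_fejer:
  assumes "averaged_map c S" "0 < \<alpha>" "nominal_step S \<alpha> y y'" "S z = z"
  shows "\<alpha> * (1 + c - \<alpha>) * (norm (residual S y))\<^sup>2 \<le> (norm (y - z))\<^sup>2 - (norm (y' - z))\<^sup>2"
proof -
  define r where "r = residual S y"
  have "2 * ((y - z) \<bullet> r) \<le> - (1 + c) * (norm r)\<^sup>2"
    using averaged_map_cocoercive[OF assms(1), of y z] assms(4)
    by (simp add: residual_def r_def)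
  then have "\<alpha> * (2 * ((y - z) \<bullet> r)) \<le> \<alpha> * (- (1 + c) * (norm r)\<^sup>2)"
    using assms(2) by (intro mult_left_mono) auto
  moreover have "y' - z = (y - z) + \<alpha> *\<^sub>R r"
    using assms(3) by (simp add: nominal_step_def r_def)
  then have "(norm (y' - z))\<^sup>2
      = (norm (y - z))\<^sup>2 + \<alpha> * (2 * ((y - z) \<bullet> r)) + \<alpha>\<^sup>2 * (norm r)\<^sup>2"
    unfolding power2_norm_eq_inner
    by (simp only: inner_add_left inner_add_right inner_commute inner_scaleR_left
        inner_scaleR_right) (simp add: inner_commute power2_eq_square algebra_simps)
  ultimately show ?thesis
    unfolding r_def[symmetric] by (simp add: algebra_simps power2_eq_square)
qed

text \<open>The squared distances to \<open>z\<close> decrease and are bounded below, so their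
  successive differences vanish; these dominate a positive multiple of the squared residual.\<close>

lemma nominal_steps_residual_tendsto_0:
  assumes "averaged_map c S" "0 < \<alpha>" "\<alpha> < 1 + c" "S z = z"
    and "\<And>k. nominal_step S \<alpha> (x k) (x (Suc k))"
  shows "(\<lambda>k. norm (residual S (x k))) \<longlonglongrightarrow> 0"
proof -
  define D where "D k = (norm (x k - z))\<^sup>2" for k
  define m where "m = \<alpha> * (1 + c - \<alpha>)"
  have m: "m > 0" using assms(2,3) by (simp add: m_def)
  have fejer: "m * (norm (residual S (x k)))\<^sup>2 \<le> D k - D (Suc k)" for k
    using nominal_step_fejer[OF assms(1,2,5,4)] by (simp add: m_def D_def)
  have "D (Suc k) \<le> D k" for k
    using fejer[of k] m by (smt (verit) mult_nonneg_nonneg zero_le_power2)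
  then have "decseq D" by (simp add: decseq_Suc_iff)
  then obtain L where "D \<longlonglongrightarrow> L"
    by (rule decseq_convergent[of D 0]) (auto simp: D_def)
  then have "(\<lambda>k. (D k - D (Suc k)) / m) \<longlonglongrightarrow> (L - L) / m"
    using m by (intro tendsto_intros LIMSEQ_Suc) auto
  then have "(\<lambda>k. (D k - D (Suc k)) / m) \<longlonglongrightarrow> 0" by simp
  then have "(\<lambda>k. (norm (residual S (x k)))\<^sup>2) \<longlonglongrightarrow> 0"
  proof (rule real_tendsto_sandwich[OF _ _ tendsto_const, rotated 2])
    show "\<forall>\<^sub>F k in sequentially. (norm (residual S (x k)))\<^sup>2 \<le> (D k - D (Suc k)) / m"
      using fejer m by (simp add: pos_le_divide_eq mult.commute)
  qed simp
  then show ?thesis by simp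
qed

section \<open>Geometric decay under repeated contractions\<close>

text \<open>Here \<open>a\<close> stands for the residual norms and \<open>L\<close> for the line
  search iterations. The sequence may rise from \<open>a k\<close> to \<open>a (Suc k)\<close> at a
  member of \<open>L\<close>; only the values just after successive members contract.\<close>

lemma tendsto_0_of_infinitely_many_contractions:
  fixes a :: "nat \<Rightarrow> real"
  assumes nonneg: "\<And>k. 0 \<le> a k" and q: "0 \<le> q" "q < 1" and inf: "infinite L"
    and dec: "\<And>k. k \<notin> L \<Longrightarrow> a (Suc k) \<le> a k"
    and contr: "\<And>k. k \<in> L \<Longrightarrow> {i \<in> L. i < k} \<noteq> {} \<Longrightarrow> a (Suc k) \<le> q * a (Suc (Max {i \<in> L. i < k}))"
  shows "a \<longlonglongrightarrow> 0"
proof -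
  have prev: "Max {i \<in> L. i < k} \<in> L \<and> l \<le> Max {i \<in> L. i < k} \<and> Max {i \<in> L. i < k} < k"
    and contr': "k \<in> L \<Longrightarrow> a (Suc k) \<le> q * a (Suc (Max {i \<in> L. i < k}))"
    if "l \<in> L" "l < k" for k l
  proof -
    have *: "finite {i \<in> L. i < k}" "l \<in> {i \<in> L. i < k}" using that by auto
    then have "Max {i \<in> L. i < k} \<in> {i \<in> L. i < k}" by (intro Max_in) auto
    then show "Max {i \<in> L. i < k} \<in> L \<and> l \<le> Max {i \<in> L. i < k} \<and> Max {i \<in> L. i < k} < k"
      using Max_ge[OF *] by auto
    show "k \<in> L \<Longrightarrow> a (Suc k) \<le> q * a (Suc (Max {i \<in> L. i < k}))"
      using *(2) by (intro contr) auto
  qed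
  have later: "\<exists>l\<in>L. N \<le> l" for N
    using inf by (meson infinite_nat_iff_unbounded_le)
  obtain l where l: "l \<in> L" using later by blast
  \<comment> \<open>Strong induction is needed because at a member of \<open>L\<close> the
    comparison reaches back to the previous member, possibly far before \<open>k\<close>.\<close>
  have bounded: "l \<le> k \<Longrightarrow> a (Suc k) \<le> a (Suc l)" for k
  proof (induction k rule: less_induct)
    case (less k)
    consider "k = l" | "l < k" "k \<notin> L" | "l < k" "k \<in> L" using less.prems by linarith
    then show ?case
    proof cases
      case 2
      then have "a k \<le> a (Suc l)"
        using less.IH[of "k - 1"] by simp
      then show ?thesis using dec[OF 2(2)] by linarith
    next
      case 3
      let ?p = "Max {i \<in> L. i < k}"
      have "q * a (Suc ?p) \<le> 1 * a (Suc ?p)"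
        using q nonneg by (intro mult_right_mono) auto
      moreover have "a (Suc ?p) \<le> a (Suc l)"
        using prev[OF l 3(1)] less.IH by blast
      ultimately show ?thesis using contr'[OF l 3(1,2)] by linarith
    qed simp
  qed
  have eventually_le: "\<exists>N. \<forall>k\<ge>N. a k \<le> q ^ j * a (Suc l)" for j
  proof (induction j)
    case 0
    have "a k \<le> a (Suc l)" if "Suc l \<le> k" for k
      using bounded[of "k - 1"] that by simp
    then show ?case by auto
  next
    case (Suc j)
    then obtain N where N: "\<And>k. N \<le> k \<Longrightarrow> a k \<le> q ^ j * a (Suc l)" by blast
    \<comment> \<open>Two members are chosen so that every member \<open>k \<ge> t\<close> has its
      predecessor in \<open>L\<close> at \<open>s\<close> or later, hence past \<open>N\<close>; the
      test at \<open>k\<close> then gains one factor \<open>q\<close>.\<close>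
    obtain s where s: "s \<in> L" "N \<le> s" using later by blast
    obtain t where t: "t \<in> L" "Suc s \<le> t" using later by blast
    have jump: "a (Suc k) \<le> q ^ Suc j * a (Suc l)" if "k \<in> L" "t \<le> k" for k
    proof -
      have "s < k" using t that by simp
      then have "N \<le> Suc (Max {i \<in> L. i < k})" using prev[OF s(1)] s(2) by fastforce
      then have "q * a (Suc (Max {i \<in> L. i < k})) \<le> q * (q ^ j * a (Suc l))"
        using N q by (intro mult_left_mono) auto
      then show ?thesis using contr'[OF s(1) \<open>s < k\<close> that(1)] by (simp add: mult.assoc)
    qed
    \<comment> \<open>From \<open>Suc t\<close> on, a member of \<open>L\<close> reestablishes the
      bound by \<open>jump\<close>, and any other step preserves it.\<close>
    have "a k \<le> q ^ Suc j * a (Suc l)" if "Suc t \<le> k" for k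
      using that
    proof (induction k rule: dec_induct)
      case base
      then show ?case using jump t(1) by blast
    next
      case (step k)
      then show ?case using jump[of k] dec[of k] by fastforce
    qed
    then show ?case by blast
  qed
  show ?thesis
  proof (rule LIMSEQ_I)
    fix e :: real
    assume "0 < e"
    have "(\<lambda>j. q ^ j * a (Suc l)) \<longlonglongrightarrow> 0"
      using q by (intro tendsto_mult_left_zero LIMSEQ_power_zero) auto
    then have "eventually (\<lambda>j. q ^ j * a (Suc l) < e) sequentially"
      using \<open>0 < e\<close> by (rule order_tendstoD)
    then obtain j where "q ^ j * a (Suc l) < e" by (auto simp: eventually_sequentially)
    then show "\<exists>N. \<forall>k\<ge>N. norm (a k - 0) < e"
      using eventually_le[of j] nonneg by fastforce
  qed
qed

section \<open>Convergence for an averaged operator\<close>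

lemma projected_line_search_residual_tendsto_0:
  assumes S: "averaged_map c S" "0 < \<alpha>" "\<alpha> < 1 + c" "S z = z"
    and \<epsilon>: "0 < \<epsilon>" "\<epsilon> < 1"
    and "projected_line_search C S \<alpha> \<alpha>max \<epsilon> x"
  shows "(\<lambda>k. residual S (x k)) \<longlonglongrightarrow> 0"
proof -
  obtain L where nominal: "\<And>k. k \<notin> L \<Longrightarrow> nominal_step S \<alpha> (x k) (x (Suc k))"
    and accepted: "\<And>k. k \<in> L \<Longrightarrow> line_search_accepted S \<epsilon> L x k"
    using assms(7) unfolding projected_line_search_def by blast
  have "(\<lambda>k. norm (residual S (x k))) \<longlonglongrightarrow> 0"
  proof (cases "finite L")
    case True
    then obtain N where "\<forall>k\<in>L. k < N" using finite_nat_set_iff_bounded by blast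
    \<comment> \<open>The tail shifted by \<open>N\<close> lies past every line search step, so it
      consists of nominal steps only.\<close>
    then have "nominal_step S \<alpha> (x (k + N)) (x (Suc k + N))" for k
      using nominal[of "k + N"] by fastforce
    then have "(\<lambda>k. norm (residual S (x (k + N)))) \<longlonglongrightarrow> 0"
      by (rule nominal_steps_residual_tendsto_0[OF S])
    then show ?thesis by (rule LIMSEQ_offset)
  next
    case False
    show ?thesis
    proof (rule tendsto_0_of_infinitely_many_contractions[OF _ _ _ False])
      show "norm (residual S (x (Suc k))) \<le> norm (residual S (x k))" if "k \<notin> L" for k
        using nominal_step_residual_le[OF S(1-3) nominal[OF that]] .
      show "norm (residual S (x (Suc k)))
          \<le> (1 - \<epsilon>) * norm (residual S (x (Suc (Max {i \<in> L. i < k}))))"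
        if "k \<in> L" "{i \<in> L. i < k} \<noteq> {}" for k
        using accepted[OF that(1)] that(2) by (simp add: line_search_accepted_def)
    qed (use \<epsilon> in auto)
  qed
  then show ?thesis by (simp only: tendsto_norm_zero_iff)
qed

section \<open>Admissible parameters\<close>

text \<open>Identifies the step bound of A1 with \<open>1 + c\<close> for the composed constant
  \<open>c\<close>: with \<open>s\<close> and \<open>t\<close> the reciprocals of the two
  averagedness constants, both sides equal \<open>1 + 1 / (s + t)\<close>.\<close>

lemma inverse_beta:
  assumes "0 < \<alpha>1" "\<alpha>1 < 2" "0 < \<alpha>2" "\<alpha>2 < 2"
  shows "1 / beta \<alpha>1 \<alpha>2
    = 1 + (2 - \<alpha>1) / \<alpha>1 * ((2 - \<alpha>2) / \<alpha>2) / ((2 - \<alpha>1) / \<alpha>1 + (2 - \<alpha>2) / \<alpha>2)"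
proof -
  define s t where "s = \<alpha>1 / (2 - \<alpha>1)" and "t = \<alpha>2 / (2 - \<alpha>2)"
  have st: "s > 0" "t > 0" using assms by (auto simp: s_def t_def)
  have inv: "(2 - \<alpha>1) / \<alpha>1 = 1 / s" "(2 - \<alpha>2) / \<alpha>2 = 1 / t" by (simp_all add: s_def t_def)
  have "s + t \<noteq> 0" using st by simp
  then have "1 / ((s + t) / (1 + s + t)) = 1 + 1 / s * (1 / t) / (1 / s + 1 / t)"
    using st by (simp add: divide_simps) (simp add: algebra_simps)
  then show ?thesis
    unfolding beta_def inv by (simp add: s_def t_def)
qed

theorem theorem1:
  fixes C D :: "(real ^ 'n) set"
    and S :: "real ^ 'n \<Rightarrow> real ^ 'n"
    and \<alpha>1 \<alpha>2 \<alpha> \<alpha>max \<epsilon> :: real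
    and x :: "nat \<Rightarrow> real ^ 'n"
  assumes "C \<noteq> {}" "closed C" "convex C" "affine C"
    and "D \<noteq> {}" "closed D" "convex D"
    and "C \<inter> D \<noteq> {}"
    and "S = relaxed_projection \<alpha>2 D \<circ> relaxed_projection \<alpha>1 C"
    and "(\<alpha>1 \<in> {0<..<2} \<and> \<alpha>2 \<in> {0<..<2} \<and> \<alpha> \<in> {0<..<1 / beta \<alpha>1 \<alpha>2}) \<or>
         (\<alpha> \<in> {0<..<1} \<and> \<alpha>1 \<in> {0<..2} \<and> \<alpha>2 \<in> {0<..2} \<and> \<not> (\<alpha>1 = 2 \<and> \<alpha>2 = 2)) \<or>
         (\<alpha> \<in> {0<..<1} \<and> \<alpha>1 = 2 \<and> \<alpha>2 = 2)"
    and "\<epsilon> \<in> {0<..<1}"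
    and "\<alpha>max \<ge> \<alpha>"
    and "projected_line_search C S \<alpha> \<alpha>max \<epsilon> x"
  shows "(\<lambda>k. residual S (x k)) \<longlonglongrightarrow> 0"
proof -
  let ?c1 = "(2 - \<alpha>1) / \<alpha>1" and ?c2 = "(2 - \<alpha>2) / \<alpha>2"
  let ?c = "?c1 * ?c2 / (?c1 + ?c2)"
  have pos: "0 < \<alpha>1" "0 < \<alpha>2" "0 < \<alpha>" using assms(10) by auto
  have nonneg: "0 \<le> ?c1" "0 \<le> ?c2" using assms(10) by auto
  have "averaged_map ?c S"
    unfolding assms(9) using assms(1-3,5-7) pos nonneg
    by (intro averaged_map_comp averaged_map_relaxed_projection) auto
  moreover have "\<alpha> < 1 + ?c"
  proof -
    \<comment> \<open>In A2 and A3 \<open>?c\<close> may be 0, so \<alpha> < 1 has to suffice; in A1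
      the larger bound comes from \<open>inverse_beta\<close>.\<close>
    have "0 \<le> ?c"
      by (rule divide_nonneg_nonneg[OF mult_nonneg_nonneg[OF nonneg] add_nonneg_nonneg[OF nonneg]])
    then have "\<alpha> < 1 + ?c" if "\<alpha> < 1" using that by linarith
    moreover have "\<alpha> < 1 + ?c" if "\<alpha>1 < 2" "\<alpha>2 < 2" "\<alpha> < 1 / beta \<alpha>1 \<alpha>2"
      using that(3) unfolding inverse_beta[OF pos(1) that(1) pos(2) that(2)] .
    ultimately show ?thesis
      using assms(10) unfolding greaterThanLessThan_iff by blast
  qed
  \<comment> \<open>A common point is fixed by both projections, hence by their relaxations and by
    \<open>S\<close>.\<close>
  moreover obtain z where "z \<in> C" "z \<in> D" using assms(8) by blast
  then have "S z = z"
    by (simp add: assms(9) relaxed_projection_def closest_point_self scaleR_left_diff_distrib)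
  moreover have "0 < \<epsilon>" "\<epsilon> < 1" using assms(11) by auto
  ultimately show ?thesis
    using projected_line_search_residual_tendsto_0[of ?c S \<alpha> z \<epsilon> C \<alpha>max x] pos(3) assms(13)
    by blast
qed

end
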